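(* Let $(\Omega^\bullet,d)$ be a differential calculus on an algebra $A$, and let $V$ be a vector space of derivations on $A$, closed under commutator, for which the interior products and Lie derivatives are well defined. For all $\theta,\phi\in V$, all $n\ge 0$ and all $\omega\in\Omega^n$, $$\phi\lrcorner(\theta\lrcorner\,\omega)=-\,\theta\lrcorner(\phi\lrcorner\,\omega).$$
   Context: $A$ is an associative unital (not necessarily commutative) algebra over a field. A differential calculus on $A$ is a collection of $A$-bimodules $\Omega^n$, $n\ge 0$, with $\Omega^0=A$, with an associative graded product $\Omega^n\times\Omega^m\to\Omega^{n+m}$ extending the bimodule structure, and with a linear signed derivation $d:\Omega^n\to\Omega^{n+1}$, i.e. $d(\omega\tau)=d(\omega)\,\tau+(-1)^{|\omega|}\omega\,d(\tau)$ (where $|\omega|=n$ if $\omega\in\Omega^n$), such that $d^2=0$ and $\Omega^{n+1}$ is spanned by the elements $\omega\,db$ with $\omega\in\Omega^n$, $b\in A$. Everything is purely algebraic (no topology). $V$ is a vector space of linear maps $\theta:A\to A$ with $\theta(ab)=\theta(a)b+a\theta(b)$, closed under the commutator $[\theta,\phi]=\theta\phi-\phi\theta$. Interior product: for $\theta\in V$, $\theta\lrcorner:\Omega^{n+1}\to\Omega^n$ is the linear map determined by $\theta\lrcorner a=0$ for $a\in\Omega^0=A$, $\theta\lrcorner da=\theta(a)$, and $\theta\lrcorner(\omega\tau)=(\theta\lrcorner\,\omega)\tau+(-1)^{|\omega|}\omega(\theta\lrcorner\tau)$. Lie derivative: for $\theta\in V$, ${\cal L}_\theta:\Omega^n\to\Omega^n$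 is the linear map determined by ${\cal L}_\theta(a)=\theta(a)$ for $a\in\Omega^0=A$, ${\cal L}_\theta(da)=d(\theta(a))$, and ${\cal L}_\theta(\omega\tau)={\cal L}_\theta(\omega)\tau+\omega{\cal L}_\theta(\tau)$. Standing assumption: for every $\theta\in V$ the maps $\theta\lrcorner$ and ${\cal L}_\theta$ are well defined on all of $\Omega^\bullet$ (i.e. compatible with all relations in the calculus). *)

theory Defs
  imports Complex_Main
begin

(* The sort {ring, monoid_mult} is used instead of ring_1 because the latter
   excludes the zero algebra. *)

locale unital_algebra = vector_space scale
  for scale :: "'k::field \<Rightarrow> 'a::{ring,monoid_mult} \<Rightarrow> 'a" +
  assumes scale_mult_left: "scale c x * y = scale c (x * y)"
    and scale_mult_right: "x * scale c y = scale c (x * y)"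

(* The type 'w is the total space of the calculus, the direct sum of the Omega n,
   and its ring multiplication is the graded product.  The identification of A
   (the type 'a) with Omega 0 is the map emb, so the bimodule actions of a in A
   are w |-> emb a * w and w |-> w * emb a.  Linear maps between the homogeneous
   components are given as linear maps on 'w that respect the degrees.
   The signs (-1)^n are scalars in the field. *)

locale differential_calculus =
  A: unital_algebra scaleA + W: unital_algebra scaleW
  for scaleA :: "'k::field \<Rightarrow> 'a::{ring,monoid_mult} \<Rightarrow> 'a"
    and scaleW :: "'k \<Rightarrow> 'w::{ring,monoid_mult} \<Rightarrow> 'w" +
  fixes Omega :: "nat \<Rightarrow> 'w set"
    and emb :: "'a \<Rightarrow> 'w"
    and d :: "'w \<Rightarrow> 'w"
  assumes subspace_Omega: "W.subspace (Omega n)"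
    and direct_sum: "\<exists>!c. (\<forall>n. c n \<in> Omega n) \<and> finite {n. c n \<noteq> 0} \<and> w = (\<Sum>n | c n \<noteq> 0. c n)"
    and mult_Omega: "\<omega> \<in> Omega n \<Longrightarrow> \<tau> \<in> Omega m \<Longrightarrow> \<omega> * \<tau> \<in> Omega (n + m)"
    and linear_emb: "Vector_Spaces.linear scaleA scaleW emb"
    and emb_one: "emb 1 = 1"
    and emb_mult: "emb (a * b) = emb a * emb b"
    and inj_emb: "inj emb"
    and range_emb: "range emb = Omega 0"
    and linear_d: "Vector_Spaces.linear scaleW scaleW d"
    and d_Omega: "\<omega> \<in> Omega n \<Longrightarrow> d \<omega> \<in> Omega (Suc n)"
    and d_mult: "\<omega> \<in> Omega n \<Longrightarrow> \<tau> \<in> Omega m \<Longrightarrow>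
                   d (\<omega> * \<tau>) = d \<omega> * \<tau> + scaleW ((-1) ^ n) (\<omega> * d \<tau>)"
    and d_d: "d (d w) = 0"
    and Omega_Suc: "Omega (Suc n) = W.span {\<omega> * d (emb b) | \<omega> b. \<omega> \<in> Omega n}"

definition is_derivation :: "('k::field \<Rightarrow> 'a::{ring,monoid_mult} \<Rightarrow> 'a) \<Rightarrow> ('a \<Rightarrow> 'a) \<Rightarrow> bool"
  where "is_derivation scaleA \<theta> \<longleftrightarrow>
    Vector_Spaces.linear scaleA scaleA \<theta> \<and> (\<forall>a b. \<theta> (a * b) = \<theta> a * b + a * \<theta> b)"

locale derivation_space = unital_algebra scaleA
  for scaleA :: "'k::field \<Rightarrow> 'a::{ring,monoid_mult} \<Rightarrow> 'a" +
  fixes V :: "('a \<Rightarrow> 'a) set"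
  assumes derivation: "\<theta> \<in> V \<Longrightarrow> is_derivation scaleA \<theta>"
    and zero_in: "(\<lambda>a. 0) \<in> V"
    and add_in: "\<theta> \<in> V \<Longrightarrow> \<phi> \<in> V \<Longrightarrow> (\<lambda>a. \<theta> a + \<phi> a) \<in> V"
    and scale_in: "\<theta> \<in> V \<Longrightarrow> (\<lambda>a. scaleA c (\<theta> a)) \<in> V"
    and commutator_in: "\<theta> \<in> V \<Longrightarrow> \<phi> \<in> V \<Longrightarrow> (\<lambda>a. \<theta> (\<phi> a) - \<phi> (\<theta> a)) \<in> V"

definition is_interior_product ::
  "('k::field \<Rightarrow> 'w::{ring,monoid_mult} \<Rightarrow> 'w) \<Rightarrow> (nat \<Rightarrow> 'w set) \<Rightarrow> ('a \<Rightarrow> 'w) \<Rightarrow> ('w \<Rightarrow> 'w) \<Rightarrow>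
    ('a \<Rightarrow> 'a) \<Rightarrow> ('w \<Rightarrow> 'w) \<Rightarrow> bool"
  where "is_interior_product scaleW Omega emb d \<theta> i \<longleftrightarrow>
    Vector_Spaces.linear scaleW scaleW i \<and>
    (\<forall>n. \<forall>\<omega>\<in>Omega (Suc n). i \<omega> \<in> Omega n) \<and>
    (\<forall>a. i (emb a) = 0) \<and>
    (\<forall>a. i (d (emb a)) = emb (\<theta> a)) \<and>
    (\<forall>n m. \<forall>\<omega>\<in>Omega n. \<forall>\<tau>\<in>Omega m.
       i (\<omega> * \<tau>) = i \<omega> * \<tau> + scaleW ((-1) ^ n) (\<omega> * i \<tau>))"

definition is_Lie_derivative ::
  "('k::field \<Rightarrow> 'w::{ring,monoid_mult} \<Rightarrow> 'w) \<Rightarrow> (nat \<Rightarrow> 'w set) \<Rightarrow> ('a \<Rightarrow> 'w) \<Rightarrow> ('w \<Rightarrow> 'w) \<Rightarrow>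
    ('a \<Rightarrow> 'a) \<Rightarrow> ('w \<Rightarrow> 'w) \<Rightarrow> bool"
  where "is_Lie_derivative scaleW Omega emb d \<theta> L \<longleftrightarrow>
    Vector_Spaces.linear scaleW scaleW L \<and>
    (\<forall>n. \<forall>\<omega>\<in>Omega n. L \<omega> \<in> Omega n) \<and>
    (\<forall>a. L (emb a) = emb (\<theta> a)) \<and>
    (\<forall>a. L (d (emb a)) = d (emb (\<theta> a))) \<and>
    (\<forall>n m. \<forall>\<omega>\<in>Omega n. \<forall>\<tau>\<in>Omega m. L (\<omega> * \<tau>) = L \<omega> * \<tau> + \<omega> * L \<tau>)"

(* The defining rules determine at most one map on a differential calculus
   (interior_product_unique below), so well-definedness means existence. *)

definition interior_product ::
  "('k::field \<Rightarrow> 'w::{ring,monoid_mult} \<Rightarrow> 'w) \<Rightarrow> (nat \<Rightarrow> 'w set) \<Rightarrow> ('a \<Rightarrow> 'w) \<Rightarrow> ('w \<Rightarrow> 'w) \<Rightarrow>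
    ('a \<Rightarrow> 'a) \<Rightarrow> 'w \<Rightarrow> 'w"
  where "interior_product scaleW Omega emb d \<theta> =
    (THE i. is_interior_product scaleW Omega emb d \<theta> i)"

lemma (in differential_calculus) interior_product_unique:
  assumes i: "is_interior_product scaleW Omega emb d \<theta> i"
    and j: "is_interior_product scaleW Omega emb d \<theta> j"
  shows "i = j"
proof -
  have li: "Vector_Spaces.linear scaleW scaleW i" and lj: "Vector_Spaces.linear scaleW scaleW j"
    using i j unfolding is_interior_product_def by blast+
  interpret i: Vector_Spaces.linear scaleW scaleW i by (rule li)
  interpret j: Vector_Spaces.linear scaleW scaleW j by (rule lj)
  have hom: "\<omega> \<in> Omega n \<Longrightarrow> i \<omega> = j \<omega>" for n \<omega>
  proof (induction n arbitrary: \<omega>)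
    case 0
    then obtain a where "\<omega> = emb a" using range_emb by blast
    then show ?case using i j unfolding is_interior_product_def by simp
  next
    case (Suc n)
    have "\<omega> \<in> W.span {\<omega> * d (emb b) | \<omega> b. \<omega> \<in> Omega n}"
      using Suc.prems Omega_Suc by simp
    then show ?case
    proof (induction rule: W.span_induct_alt)
      case base
      show ?case by (simp add: i.zero j.zero)
    next
      case (step c x y)
      then obtain \<eta> b where x: "x = \<eta> * d (emb b)" and \<eta>: "\<eta> \<in> Omega n" by blast
      have db: "d (emb b) \<in> Omega (Suc 0)" using d_Omega range_emb by blast
      have "i x = j x"
        using i j \<eta> db Suc.IH[OF \<eta>] unfolding x is_interior_product_def by metis
      then show ?case using step by (simp add: i.add j.add i.scale j.scale)
    qed
  qed
  show ?thesis
  proof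
    fix w
    obtain c where c: "\<And>n. c n \<in> Omega n" "w = (\<Sum>n | c n \<noteq> 0. c n)"
      using direct_sum[of w] by blast
    show "i w = j w" unfolding c(2) i.sum j.sum using hom[OF c(1)] by simp
  qed
qed

end

theory Submission imports Defs
begin

text \<open>The proof is an induction on the degree. On \<open>A\<close> both composites vanish, and
  forms of degree n+1 are linear combinations of products \<eta> db with \<eta> of degree n, so it
  suffices to treat these. Write i, j for the interior products with \<theta>, \<phi>. Two
  applications of the signed Leibniz rule give j(i(\<eta> db)) = j(i \<eta>) db + (-1)^n ((j \<eta>)
  \<theta>(b) - (i \<eta>) \<phi>(b)), which is \<open>interior_product_mult_d\<close>. The bracket
  changes sign when (i, \<theta>) and (j, \<phi>) are exchanged, and the first term does so by the
  induction hypothesis; \<open>interior_product_anticommute\<close> assembles this.\<close>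

lemma (in differential_calculus) interior_product_mult_d:
  assumes i: "is_interior_product scaleW Omega emb d \<theta> i"
    and j: "is_interior_product scaleW Omega emb d \<phi> j"
    and \<eta>: "\<eta> \<in> Omega n"
  shows "j (i (\<eta> * d (emb b))) = j (i \<eta>) * d (emb b)
    + scaleW ((-1) ^ n) (j \<eta> * emb (\<theta> b)) - scaleW ((-1) ^ n) (i \<eta> * emb (\<phi> b))"
proof -
  have "Vector_Spaces.linear scaleW scaleW i" "Vector_Spaces.linear scaleW scaleW j"
    using i j unfolding is_interior_product_def by blast+
  then interpret i: Vector_Spaces.linear scaleW scaleW i
    + j: Vector_Spaces.linear scaleW scaleW j .
  have ir: "\<And>a. i (emb a) = 0" "\<And>n \<omega>. \<omega> \<in> Omega (Suc n) \<Longrightarrow> i \<omega> \<in> Omega n"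
      "\<And>a. i (d (emb a)) = emb (\<theta> a)"
      "\<And>n m \<omega> \<tau>. \<omega> \<in> Omega n \<Longrightarrow> \<tau> \<in> Omega m \<Longrightarrow>
         i (\<omega> * \<tau>) = i \<omega> * \<tau> + scaleW ((-1) ^ n) (\<omega> * i \<tau>)"
    using i unfolding is_interior_product_def by blast+
  have jr: "\<And>a. j (emb a) = 0" "\<And>a. j (d (emb a)) = emb (\<phi> a)"
      "\<And>n m \<omega> \<tau>. \<omega> \<in> Omega n \<Longrightarrow> \<tau> \<in> Omega m \<Longrightarrow>
         j (\<omega> * \<tau>) = j \<omega> * \<tau> + scaleW ((-1) ^ n) (\<omega> * j \<tau>)"
    using j unfolding is_interior_product_def by blast+
  have emb0: "emb a \<in> Omega 0" for a using range_emb by blast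
  have db: "d (emb b) \<in> Omega (Suc 0)" using d_Omega emb0 by blast
  have j_mult_emb: "j (\<eta> * emb (\<theta> b)) = j \<eta> * emb (\<theta> b)"
    using jr(3)[OF \<eta> emb0] by (simp add: jr(1))
  have "j (i \<eta> * d (emb b)) = j (i \<eta>) * d (emb b) - scaleW ((-1) ^ n) (i \<eta> * emb (\<phi> b))"
  \<comment> \<open>The form \<open>i \<eta>\<close> has degree n - 1, which exists only for
    positive n. In degree 0 it is zero, and both sides vanish.\<close>
  proof (cases n)
    case 0
    then obtain a where "\<eta> = emb a" using \<eta> range_emb by blast
    then show ?thesis by (simp add: ir(1) j.zero)
  next
    case (Suc k)
    with \<eta> have "i \<eta> \<in> Omega k" using ir(2) by simp
    \<comment> \<open>The minus sign arises here: moving \<open>j\<close> past the form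
      \<open>i \<eta>\<close> of degree k costs (-1)^k = -(-1)^n.\<close>
    from jr(3)[OF this db] show ?thesis by (simp add: jr(2) Suc)
  qed
  then show ?thesis
    using ir(4)[OF \<eta> db] by (simp add: ir(3) j.add j.scale j_mult_emb)
qed

text \<open>Only the defining rules of the two maps enter, so the argument can be carried out for
  any maps satisfying them, before a definite description is involved.\<close>

lemma (in differential_calculus) interior_product_anticommute:
  assumes i: "is_interior_product scaleW Omega emb d \<theta> i"
    and j: "is_interior_product scaleW Omega emb d \<phi> j"
    and "\<omega> \<in> Omega n"
  shows "j (i \<omega>) = - i (j \<omega>)"
proof -
  have "Vector_Spaces.linear scaleW scaleW i" "Vector_Spaces.linear scaleW scaleW j"
    using i j unfolding is_interior_product_def by blast+
  then interpret i: Vector_Spaces.linear scaleW scaleW i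
    + j: Vector_Spaces.linear scaleW scaleW j .
  from \<open>\<omega> \<in> Omega n\<close> show ?thesis
  proof (induction n arbitrary: \<omega>)
    case 0
    then obtain a where "\<omega> = emb a" using range_emb by blast
    then show ?case
      using i j unfolding is_interior_product_def by (simp add: i.zero j.zero)
  next
    case (Suc n)
    have "\<omega> \<in> W.span {\<omega> * d (emb b) | \<omega> b. \<omega> \<in> Omega n}"
      using Suc.prems Omega_Suc by simp
    then show ?case
    proof (induction rule: W.span_induct_alt)
      case base
      show ?case by (simp add: i.zero j.zero)
    next
      case (step c x y)
      then obtain \<eta> b where x: "x = \<eta> * d (emb b)" and \<eta>: "\<eta> \<in> Omega n" by blast
      \<comment> \<open>Both composites are expanded by the same formula, the second with the roles
        of (i, \<theta>) and (j, \<phi>) exchanged. The terms without \<open>d\<close> then cancel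
        in the sum, and the induction hypothesis for \<eta> settles the rest.\<close>
      have "j (i x) = - i (j x)"
        unfolding x interior_product_mult_d[OF i j \<eta>] interior_product_mult_d[OF j i \<eta>]
        using Suc.IH[OF \<eta>] by simp
      then show ?case using step by (simp add: i.add j.add i.scale j.scale)
    qed
  qed
qed

text \<open>Existence together with \<open>interior_product_unique\<close> makes the definite
  description denote, so the chosen map inherits the defining rules.\<close>

lemma (in differential_calculus) is_interior_product_interior_product:
  assumes "is_interior_product scaleW Omega emb d \<theta> i"
  shows "is_interior_product scaleW Omega emb d \<theta> (interior_product scaleW Omega emb d \<theta>)"
  unfolding interior_product_def
  by (rule theI[where P = "is_interior_product scaleW Omega emb d \<theta>",
        OF assms interior_product_unique[OF _ assms]])

theorem proposition2p8:
  fixes scaleA :: "'k::field \<Rightarrow> 'a::{ring,monoid_mult} \<Rightarrow> 'a"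
    and scaleW :: "'k \<Rightarrow> 'w::{ring,monoid_mult} \<Rightarrow> 'w"
    and Omega :: "nat \<Rightarrow> 'w set"
    and emb :: "'a \<Rightarrow> 'w"
    and d :: "'w \<Rightarrow> 'w"
    and V :: "('a \<Rightarrow> 'a) set"
    and \<theta> \<phi> :: "'a \<Rightarrow> 'a"
    and n :: nat
    and \<omega> :: 'w
  assumes "differential_calculus scaleA scaleW Omega emb d"
    and "derivation_space scaleA V"
    and "\<forall>\<eta>\<in>V. \<exists>i. is_interior_product scaleW Omega emb d \<eta> i"
    and "\<forall>\<eta>\<in>V. \<exists>L. is_Lie_derivative scaleW Omega emb d \<eta> L"
    and "\<theta> \<in> V" and "\<phi> \<in> V" and "\<omega> \<in> Omega n"
  shows "interior_product scaleW Omega emb d \<phi> (interior_product scaleW Omega emb d \<theta> \<omega>) =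
         - interior_product scaleW Omega emb d \<theta> (interior_product scaleW Omega emb d \<phi> \<omega>)"
proof -
  interpret differential_calculus scaleA scaleW Omega emb d by fact
  have "is_interior_product scaleW Omega emb d \<eta> (interior_product scaleW Omega emb d \<eta>)"
    if "\<eta> \<in> V" for \<eta>
    using assms(3) that is_interior_product_interior_product by metis
  from interior_product_anticommute[OF this[OF \<open>\<theta> \<in> V\<close>] this[OF \<open>\<phi> \<in> V\<close>] \<open>\<omega> \<in> Omega n\<close>]
  show ?thesis .
qed

end
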